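(* Let $k,r$ be positive integers with $r\le k$, and write $k=\alpha r+\beta$ with integers $\alpha\ge1$, $0\le\beta\le r-1$. Define blocks $B_1,\dots,B_n\subseteq[k]$ as follows. (i) If $\beta=0$ and $n\ge\alpha$: $B_i=[(i-1)r+1,(i-1)r+r]$ for $i\in[\alpha]$, and $B_i=[k]$ for $i\in[\alpha+1,n]$. (ii) If $\beta>0$ and $n\ge\alpha+r$: $B_i=[(i-1)r+1,(i-1)r+r]$ for $i\in[\alpha]$; $B_i=[k]\setminus\{i-\alpha,\,i-\alpha+r,\,i-\alpha+2r,\dots,i-\alpha+(\alpha-1)r\}$ for $i\in[\alpha+1,\alpha+r]$; and $B_i=[k]$ for $i\in[\alpha+r+1,n]$. For $j\in[k]$ let $C_j=\{i\in[n]: j\in B_i\}$. Then in either case $\{C_1,\dots,C_k\}$ is an $(n,N,k,k;r)$-MCBC with $N=kn-\left\lfloor\frac{k-1}{r}\right\rfloor k$.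
   Context: An $(n,N,k,m;r)$ multiset combinatorial batch code (MCBC) is a collection $\mathcal C=\{C_1,\dots,C_m\}$ of subsets of $[n]=\{1,\dots,n\}$ (servers) with $N=\sum_{j=1}^m|C_j|$, such that for every multiset request $\{i_1,\dots,i_k\}$ of $k$ elements of $[n]$ in which every element has multiplicity at most $r$, there exist subsets $D_j\subseteq C_j$ with $|D_j|\le 1$ ($j\in[m]$) whose multiset union (the multiplicity of $i$ being $|\{j: i\in D_j\}|$) contains the request. For integers $a\le b$, $[a,b]=\{a,a+1,\dots,b\}$ and $[a]=[1,a]$. *)

theory Defs
  imports Complex_Main "HOL-Library.Multiset"
begin

text \<open>
  The code is an indexed family \<open>C\<close> on \<open>{1..m}\<close>, so coinciding sets \<open>C j\<close> are kept apart
  and each contributes to \<open>N\<close>. The multiset union of the \<open>D j\<close> adds multiplicities, hence the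
  sum below (whereas the library's \<open>\<union>#\<close> takes maxima).
\<close>

definition is_mcbc :: "nat \<Rightarrow> nat \<Rightarrow> nat \<Rightarrow> nat \<Rightarrow> nat \<Rightarrow> (nat \<Rightarrow> nat set) \<Rightarrow> bool" where
  "is_mcbc n N k m r C \<longleftrightarrow>
     (\<forall>j\<in>{1..m}. C j \<subseteq> {1..n}) \<and>
     N = (\<Sum>j\<in>{1..m}. card (C j)) \<and>
     (\<forall>R :: nat multiset.
        size R = k \<and> set_mset R \<subseteq> {1..n} \<and> (\<forall>i. count R i \<le> r) \<longrightarrow>
        (\<exists>D. (\<forall>j\<in>{1..m}. D j \<subseteq> C j \<and> card (D j) \<le> 1) \<and>
             R \<subseteq># (\<Sum>j\<in>{1..m}. mset_set (D j))))"

lemma count_sum_mset_set: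
  assumes "\<forall>j\<in>{1..m::nat}. finite (D j)"
  shows "count (\<Sum>j\<in>{1..m}. mset_set (D j)) i = card {j\<in>{1..m}. i \<in> D j}"
proof -
  have "count (\<Sum>j\<in>{1..m}. mset_set (D j)) i = (\<Sum>j\<in>{1..m}. if i \<in> D j then 1 else 0)"
    unfolding count_sum using assms by (intro sum.cong) (auto simp: count_mset_set')
  also have "\<dots> = card {j\<in>{1..m}. i \<in> D j}"
    by (simp add: sum.If_cases Int_def)
  finally show ?thesis .
qed

text \<open>
  The blocks for \<open>k = \<alpha> * r + \<beta>\<close>; the middle branch occurs only for \<open>\<beta> > 0\<close>.
  Only indices \<open>i \<ge> 1\<close> are meaningful, so neither subtraction truncates.
\<close>

definition block :: "nat \<Rightarrow> nat \<Rightarrow> nat \<Rightarrow> nat \<Rightarrow> nat \<Rightarrow> nat set" where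
  "block k r \<alpha> \<beta> i =
     (if i \<in> {1..\<alpha>} then {(i - 1) * r + 1..(i - 1) * r + r}
      else if \<beta> > 0 \<and> i \<in> {\<alpha> + 1..\<alpha> + r} then {1..k} - {i - \<alpha> + t * r | t. t < \<alpha>}
      else {1..k})"

end

theory Submission imports Defs begin

text \<open>
  A request with multiplicities \<open>d i\<close> is served by disjoint sets \<open>S i \<subseteq> B i\<close> of size \<open>d i\<close>,
  so by Hall's theorem it suffices that \<open>sum d I \<le> card (\<Union> (B ` I))\<close> for every set \<open>I\<close> of servers.
  The first \<open>\<alpha>\<close> blocks are disjoint of size \<open>r\<close>. The complements of the next \<open>r\<close> blocks are
  transversals of these \<open>\<alpha>\<close> blocks and pairwise disjoint, so two of them already cover \<open>{1..k}\<close>, while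
  one of them together with \<open>c < \<alpha>\<close> of the first blocks covers
  \<open>k - (\<alpha> - c) \<ge> (c + 1) * r\<close> points.
\<close>

section \<open>Hall's marriage theorem\<close>

text \<open>
  Rado's argument: if neither \<open>x\<close> nor \<open>y\<close> can be removed from \<open>A p\<close>, submodularity of
  \<open>card\<close> applied to the two violating families contradicts Hall's condition.
\<close>

theorem hall_marriage:
  fixes A :: "'a \<Rightarrow> 'b set"
  assumes "finite P" and "\<And>p. p \<in> P \<Longrightarrow> finite (A p)"
    and "\<And>J. J \<subseteq> P \<Longrightarrow> card J \<le> card (\<Union> (A ` J))"
  shows "\<exists>f. inj_on f P \<and> (\<forall>p\<in>P. f p \<in> A p)"
  using assms(2,3)
proof (induction "\<Sum>p\<in>P. card (A p)" arbitrary: A rule: less_induct)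
  case less
  note finA = less.prems(1) and hall = less.prems(2)
  show ?case
  proof (cases "\<exists>p\<in>P. \<exists>x\<in>A p. \<exists>y\<in>A p. x \<noteq> y")
    \<comment> \<open>All sets are singletons here, and Hall's condition on pairs keeps them
      distinct.\<close>
    case False
    have "A p \<noteq> {}" if "p \<in> P" for p
      using hall[of "{p}"] that by auto
    then obtain f where f: "\<And>p. p \<in> P \<Longrightarrow> f p \<in> A p"
      using bchoice[of P "\<lambda>p x. x \<in> A p"] by blast
    have Af: "A p = {f p}" if "p \<in> P" for p
      using f[OF that] False that by auto
    have "inj_on f P"
    proof (rule inj_onI, rule ccontr)
      fix p q assume pq: "p \<in> P" "q \<in> P" "f p = f q" "p \<noteq> q"
      then have "\<Union> (A ` {p, q}) = {f p}"
        using Af by auto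
      then show False
        using hall[of "{p, q}"] pq by auto
    qed
    with f show ?thesis by blast
  next
    case True
    then obtain p x y where p: "p \<in> P" "x \<in> A p" "y \<in> A p" "x \<noteq> y"
      by blast
    \<comment> \<open>Representatives for the sets with \<open>z\<close> deleted from
      \<open>A p\<close> would also serve \<open>A\<close>, so by induction the smaller sets violate
      Hall's condition on some \<open>K\<close>. That \<open>K\<close> contains \<open>p\<close>;
      dropping \<open>p\<close> turns the strict violation into the \<open>\<le>\<close> for
      \<open>J = K - {p}\<close>.\<close>
    have reduce: "\<exists>J\<subseteq>P - {p}. card (\<Union> (A ` J) \<union> (A p - {z})) \<le> card J"
      if z: "z \<in> A p" and none: "\<nexists>f. inj_on f P \<and> (\<forall>p\<in>P. f p \<in> A p)" for z
    proof -
      define A' where "A' = A(p := A p - {z})"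
      have "(\<Sum>q\<in>P. card (A' q)) < (\<Sum>q\<in>P. card (A q))"
      proof (rule sum_strict_mono_ex1[OF \<open>finite P\<close>])
        show "\<forall>q\<in>P. card (A' q) \<le> card (A q)"
          by (auto simp: A'_def card_Diff1_le)
        show "\<exists>q\<in>P. card (A' q) < card (A q)"
          using card_Diff1_less[OF finA[OF p(1)] z] p(1) by (auto simp: A'_def simp del: card_Diff_insert)
      qed
      moreover have "finite (A' q)" if "q \<in> P" for q
        using finA[OF that] by (auto simp: A'_def)
      moreover have "\<nexists>f. inj_on f P \<and> (\<forall>q\<in>P. f q \<in> A' q)"
        using none by (auto simp: A'_def split: if_splits)
      ultimately obtain K where K: "K \<subseteq> P" "\<not> card K \<le> card (\<Union> (A' ` K))"
        using less.hyps[of A'] by blast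
      have "p \<in> K"
      proof (rule ccontr)
        assume "p \<notin> K"
        then have "\<Union> (A' ` K) = \<Union> (A ` K)"
          by (auto simp: A'_def split: if_splits)
        with K hall[of K] show False by simp
      qed
      then have "\<Union> (A' ` K) = \<Union> (A ` (K - {p})) \<union> (A p - {z})"
        by (auto simp: A'_def split: if_splits)
      moreover have "finite K"
        using K(1) \<open>finite P\<close> finite_subset by blast
      ultimately show ?thesis
        using K \<open>p \<in> K\<close> by (intro exI[of _ "K - {p}"]) (auto simp: card_Diff_singleton)
    qed
    show ?thesis
    proof (rule ccontr)
      assume none: "\<not> ?thesis"
      obtain J where J: "J \<subseteq> P - {p}" "card (\<Union> (A ` J) \<union> (A p - {x})) \<le> card J"
        using reduce[OF p(2) none] by blast
      obtain K where K: "K \<subseteq> P - {p}" "card (\<Union> (A ` K) \<union> (A p - {y})) \<le> card K"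
        using reduce[OF p(3) none] by blast
      let ?X = "\<Union> (A ` J) \<union> (A p - {x})" and ?Y = "\<Union> (A ` K) \<union> (A p - {y})"
      have finJK: "finite J" "finite K"
        using J(1) K(1) \<open>finite P\<close> by (auto intro: finite_subset)
      have fin: "finite ?X" "finite ?Y"
        using J(1) K(1) finJK finA p(1) by auto
      have "card (J \<union> K) + 1 = card (insert p (J \<union> K))"
        using J(1) K(1) finJK by (subst card_insert_disjoint) auto
      also have "\<dots> \<le> card (\<Union> (A ` insert p (J \<union> K)))"
        using J(1) K(1) p(1) by (intro hall) auto
      \<comment> \<open>Since \<open>x \<noteq> y\<close>, the two truncated copies of
        \<open>A p\<close> reunite to \<open>A p\<close>.\<close>
      also have "\<Union> (A ` insert p (J \<union> K)) = ?X \<union> ?Y"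
        using p by auto
      finally have union: "card (J \<union> K) + 1 \<le> card (?X \<union> ?Y)" .
      have "card (J \<inter> K) \<le> card (\<Union> (A ` (J \<inter> K)))"
        using J(1) by (intro hall) auto
      also have "\<dots> \<le> card (?X \<inter> ?Y)"
        using fin by (intro card_mono) auto
      finally show False
        using union J(2) K(2) card_Un_Int[OF fin] card_Un_Int[OF finJK] by linarith
    qed
  qed
qed

section \<open>Batch codes from Hall's condition on the blocks\<close>

text \<open>Double counting of incidences: it turns \<open>N\<close>, defined through the sets
  \<open>C j\<close>, into the sum of the block sizes.\<close>

lemma sum_card_incidence:
  assumes "finite S" and "finite T" and "\<And>i. i \<in> S \<Longrightarrow> B i \<subseteq> T"
  shows "(\<Sum>j\<in>T. card {i \<in> S. j \<in> B i}) = (\<Sum>i\<in>S. card (B i))"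
proof -
  have "(\<Sum>j\<in>T. card {i \<in> S. j \<in> B i}) = (\<Sum>i\<in>S. card {j \<in> T. j \<in> B i})"
    using assms(2,1) by (rule sum_multicount_gen) auto
  also have "\<dots> = (\<Sum>i\<in>S. card (B i))"
    using assms(3) by (intro sum.cong refl arg_cong[of _ _ card]) auto
  finally show ?thesis .
qed

text \<open>Blocks and code are transposes of each other: \<open>j \<in> B i\<close> means
  \<open>i \<in> C j\<close>. Splitting each requested \<open>i\<close> into
  \<open>count R i\<close> copies makes serving a request a matching of copies with points of their
  blocks.\<close>

lemma is_mcbc_if_hall:
  assumes B: "\<And>i. i \<in> {1..n} \<Longrightarrow> B i \<subseteq> {1..m}"
    and hall: "\<And>R I. size R = k \<Longrightarrow> set_mset R \<subseteq> {1..n} \<Longrightarrow> (\<And>i. count R i \<le> r) \<Longrightarrow>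
      I \<subseteq> {1..n} \<Longrightarrow> (\<Sum>i\<in>I. count R i) \<le> card (\<Union> (B ` I))"
  shows "is_mcbc n (\<Sum>i\<in>{1..n}. card (B i)) k m r (\<lambda>j. {i \<in> {1..n}. j \<in> B i})"
  unfolding is_mcbc_def
proof (intro conjI allI impI)
  show "(\<Sum>i\<in>{1..n}. card (B i)) = (\<Sum>j\<in>{1..m}. card {i \<in> {1..n}. j \<in> B i})"
    using B by (subst sum_card_incidence) auto
next
  fix R :: "nat multiset"
  assume R: "size R = k \<and> set_mset R \<subseteq> {1..n} \<and> (\<forall>i. count R i \<le> r)"
  define P where "P = (SIGMA i:{1..n}. {..<count R i})"
  have finB: "finite (B i)" if "i \<in> {1..n}" for i
    using B[OF that] finite_subset by blast
  have "\<exists>f. inj_on f P \<and> (\<forall>p\<in>P. f p \<in> B (fst p))"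
  proof (rule hall_marriage)
    show "finite P" unfolding P_def by auto
    show "finite (B (fst p))" if "p \<in> P" for p
      using that finB by (auto simp: P_def)
    fix J assume J: "J \<subseteq> P"
    then have I: "fst ` J \<subseteq> {1..n}" by (auto simp: P_def)
    then have fin: "finite (fst ` J)" using finite_subset by blast
    \<comment> \<open>Adding all copies of the indices met by \<open>J\<close> leaves the union of
      blocks unchanged, so Hall's condition is needed only for sets of whole indices.\<close>
    have "card J \<le> card (SIGMA i:fst ` J. {..<count R i})"
      using J fin by (intro card_mono) (force simp: P_def)+
    also have "\<dots> = (\<Sum>i\<in>fst ` J. count R i)"
      using fin by simp
    also have "\<dots> \<le> card (\<Union> (B ` fst ` J))"
      using R I by (intro hall) auto
    finally show "card J \<le> card (\<Union>p\<in>J. B (fst p))"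
      by (simp add: image_image)
  qed
  then obtain f where f: "inj_on f P" "\<And>p. p \<in> P \<Longrightarrow> f p \<in> B (fst p)"
    by blast
  \<comment> \<open>\<open>D j\<close> holds the index whose copy is matched with \<open>j\<close>;
    there is at most one because \<open>f\<close> is injective.\<close>
  define D where "D j = fst ` {p \<in> P. f p = j}" for j
  have D1: "card (D j) \<le> 1" for j
  proof -
    have "\<exists>i. D j \<subseteq> {i}"
      using f(1) by (auto simp: D_def inj_on_def)
    then obtain i where "D j \<subseteq> {i}" ..
    then show ?thesis
      using card_mono[of "{i}"] by simp
  qed
  have "finite P" unfolding P_def by auto
  then have finD: "\<forall>j\<in>{1..m}. finite (D j)" by (auto simp: D_def)
  have "R \<subseteq># (\<Sum>j\<in>{1..m}. mset_set (D j))"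
    unfolding subseteq_mset_def count_sum_mset_set[OF finD]
  proof
    fix i
    show "count R i \<le> card {j \<in> {1..m}. i \<in> D j}"
    proof (cases "i \<in> {1..n}")
      case True
      have sub: "Pair i ` {..<count R i} \<subseteq> P"
        using True by (auto simp: P_def)
      have "count R i = card (f ` Pair i ` {..<count R i})"
        using inj_on_subset[OF f(1) sub] by (subst card_image) (auto simp: card_image inj_on_def)
      also have "\<dots> \<le> card {j \<in> {1..m}. i \<in> D j}"
      proof (intro card_mono subsetI)
        fix j assume "j \<in> f ` Pair i ` {..<count R i}"
        then obtain t where t: "t < count R i" "j = f (i, t)" by auto
        then have "(i, t) \<in> P" using True by (auto simp: P_def)
        then show "j \<in> {j \<in> {1..m}. i \<in> D j}"
          using f(2)[of "(i, t)"] B[OF True] t by (force simp: D_def)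
      qed auto
      finally show ?thesis .
    next
      case False
      then have "i \<notin># R" using R by blast
      then show ?thesis by (simp add: not_in_iff)
    qed
  qed
  moreover have "D j \<subseteq> {i \<in> {1..n}. j \<in> B i}" for j
    using f(2) by (force simp: D_def P_def)
  ultimately show "\<exists>D. (\<forall>j\<in>{1..m}. D j \<subseteq> {i \<in> {1..n}. j \<in> B i} \<and> card (D j) \<le> 1) \<and>
      R \<subseteq># (\<Sum>j\<in>{1..m}. mset_set (D j))"
    using D1 by blast
qed auto

section \<open>Coordinates, sizes and unions of the blocks\<close>

text \<open>Uniqueness of division with remainder, with remainders in \<open>{1..r}\<close>;
  subtracting one brings them into the usual range. Thus a point of the first \<alpha> blocks has
  coordinates \<open>(s, t)\<close>: it is the \<open>s\<close>-th point of block
  \<open>t + 1\<close>.\<close>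

lemma add_mult_eq_iff:
  fixes r s s' t t' :: nat
  assumes "s \<in> {1..r}" and "s' \<in> {1..r}"
  shows "s + t * r = s' + t' * r \<longleftrightarrow> s = s' \<and> t = t'"
proof
  assume eq: "s + t * r = s' + t' * r"
  have "(s - 1 + t * r) div r = t" "(s' - 1 + t' * r) div r = t'"
    using assms by (auto intro!: div_nat_eqI simp: algebra_simps)
  moreover have "s - 1 + t * r = s' - 1 + t' * r"
    using eq assms by auto
  ultimately have "t = t'" by simp
  with eq show "s = s' \<and> t = t'" by simp
qed simp

locale block_code =
  fixes k r \<alpha> \<beta> n :: nat
  assumes r_pos: "r > 0"
    and k_eq: "k = \<alpha> * r + \<beta>" and alpha_pos: "\<alpha> \<ge> 1" and beta_less: "\<beta> < r"
    and n_ge: "\<beta> = 0 \<and> n \<ge> \<alpha> \<or> \<beta> > 0 \<and> n \<ge> \<alpha> + r"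
begin

abbreviation B :: "nat \<Rightarrow> nat set" where
  "B \<equiv> block k r \<alpha> \<beta>"

text \<open>The image form lets cardinality and disjointness follow directly from
  \<open>add_mult_eq_iff\<close>.\<close>

definition gap :: "nat \<Rightarrow> nat set" where
  "gap s = (\<lambda>t. s + t * r) ` {..<\<alpha>}"

lemma B_first: "i \<in> {1..\<alpha>} \<Longrightarrow> B i = {(i - 1) * r + 1..(i - 1) * r + r}"
  by (simp add: block_def)

lemma B_middle: "\<beta> > 0 \<Longrightarrow> s \<in> {1..r} \<Longrightarrow> B (\<alpha> + s) = {1..k} - gap s"
  by (auto simp: block_def gap_def)

lemma B_full: "i > \<alpha> \<Longrightarrow> \<beta> = 0 \<or> i > \<alpha> + r \<Longrightarrow> B i = {1..k}"
  by (auto simp: block_def)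

lemma mult_add_le: "t < \<alpha> \<Longrightarrow> t * r + r \<le> k"
  using mult_le_mono1[of "Suc t" \<alpha> r] by (simp add: k_eq)

lemma B_subset: "B i \<subseteq> {1..k}"
proof (cases "i \<in> {1..\<alpha>}")
  case True
  then have "(i - 1) * r + r \<le> k" by (intro mult_add_le) auto
  with True show ?thesis by (auto simp: B_first)
qed (auto simp: block_def)

lemma gap_subset: "s \<in> {1..r} \<Longrightarrow> gap s \<subseteq> {1..k}"
  using mult_add_le by (fastforce simp: gap_def)

lemma card_gap: "s \<in> {1..r} \<Longrightarrow> card (gap s) = \<alpha>"
  unfolding gap_def by (subst card_image) (auto simp: inj_on_def add_mult_eq_iff)

lemma gap_disjoint: "s \<in> {1..r} \<Longrightarrow> s' \<in> {1..r} \<Longrightarrow> s \<noteq> s' \<Longrightarrow> gap s \<inter> gap s' = {}"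
  by (auto simp: gap_def add_mult_eq_iff)

lemma B_first_eq_image: "i \<in> {1..\<alpha>} \<Longrightarrow> B i = (\<lambda>s. s + (i - 1) * r) ` {1..r}"
  by (simp add: B_first add.commute)

lemma B_first_disjoint:
  assumes "i \<in> {1..\<alpha>}" and "j \<in> {1..\<alpha>}" and "i \<noteq> j"
  shows "B i \<inter> B j = {}"
proof -
  have False if x: "x \<in> B i" "x \<in> B j" for x
  proof -
    obtain s where s: "s \<in> {1..r}" "x = s + (i - 1) * r"
      using x(1) unfolding B_first_eq_image[OF assms(1)] by blast
    obtain s' where s': "s' \<in> {1..r}" "x = s' + (j - 1) * r"
      using x(2) unfolding B_first_eq_image[OF assms(2)] by blast
    have "i - 1 = j - 1"
      using add_mult_eq_iff[OF s(1) s'(1)] s(2) s'(2) by blast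
    then show False using assms by auto
  qed
  then show ?thesis by blast
qed

lemma card_UN_first:
  assumes "J \<subseteq> {1..\<alpha>}"
  shows "card (\<Union> (B ` J)) = card J * r"
proof -
  have "card (\<Union> (B ` J)) = (\<Sum>i\<in>J. card (B i))"
  proof (intro card_UN_disjoint ballI impI)
    show "finite J" using assms finite_subset by blast
    show "finite (B i)" if "i \<in> J" for i
      using B_subset finite_subset by blast
    show "B i \<inter> B j = {}" if "i \<in> J" "j \<in> J" "i \<noteq> j" for i j
      using that assms by (intro B_first_disjoint) auto
  qed
  also have "\<dots> = (\<Sum>i\<in>J. r)"
    using assms by (intro sum.cong) (auto simp: B_first)
  finally show ?thesis by simp
qed

text \<open>Block \<open>\<alpha> + s\<close> misses only \<open>gap s\<close>, which has one point
  in each of the first \<alpha> blocks. The blocks in \<open>J\<close> recover theirs, so at most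
  \<open>\<alpha> - card J\<close> points stay uncovered.\<close>

lemma card_UN_insert_middle:
  assumes "\<beta> > 0" and s: "s \<in> {1..r}" and J: "J \<subseteq> {1..\<alpha>}"
  shows "k - (\<alpha> - card J) \<le> card (\<Union> (B ` insert (\<alpha> + s) J))"
proof -
  \<comment> \<open>The points of \<open>gap s\<close> in first blocks outside \<open>J\<close>;
    block \<open>j\<close> has \<open>t = j - 1\<close>.\<close>
  let ?X = "(\<lambda>j. s + (j - 1) * r) ` ({1..\<alpha>} - J)"
  have "card ?X \<le> card ({1..\<alpha>} - J)"
    by (intro card_image_le) auto
  also have "\<dots> = \<alpha> - card J"
    using J by (subst card_Diff_subset) (auto intro: finite_subset)
  finally have "k - (\<alpha> - card J) \<le> card {1..k} - card ?X" by simp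
  also have "\<dots> \<le> card ({1..k} - ?X)"
    by (intro diff_card_le_card_Diff) auto
  also have "\<dots> \<le> card (\<Union> (B ` insert (\<alpha> + s) J))"
  proof (intro card_mono subsetI)
    show "finite (\<Union> (B ` insert (\<alpha> + s) J))"
      by (rule finite_subset[OF UN_least finite_atLeastAtMost]) (rule B_subset)
    fix x assume x: "x \<in> {1..k} - ?X"
    show "x \<in> \<Union> (B ` insert (\<alpha> + s) J)"
    proof (cases "x \<in> gap s")
      case True
      then obtain t where t: "t < \<alpha>" "x = s + t * r" by (auto simp: gap_def)
      \<comment> \<open>Were \<open>Suc t\<close> outside \<open>J\<close>, \<open>x\<close> would
        belong to \<open>?X\<close>.\<close>
      have "Suc t \<in> J"
        using x t by (force intro: rev_image_eqI[of "Suc t"])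
      moreover have "x \<in> B (Suc t)"
        using s t by (subst B_first) auto
      ultimately show ?thesis by blast
    next
      case False
      then have "x \<in> B (\<alpha> + s)" using x assms(1) s by (simp add: B_middle)
      then show ?thesis by blast
    qed
  qed
  finally show ?thesis .
qed

section \<open>Hall's condition for the blocks\<close>

lemma hall_condition:
  fixes d :: "nat \<Rightarrow> nat"
  assumes I: "I \<subseteq> {1..n}" and d: "\<And>i. d i \<le> r" and total: "sum d I \<le> k"
  shows "sum d I \<le> card (\<Union> (B ` I))"
proof -
  have bound: "sum d J \<le> card J * r" for J
    using d sum_bounded_above[of J d r] by simp
  \<comment> \<open>A union that is all of \<open>{1..k}\<close> meets any total demand; this
    settles the cases \<open>full\<close> and \<open>two\<close>.\<close>
  have whole: ?thesis if "{1..k} \<subseteq> \<Union> (B ` I)"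
  proof -
    have "\<Union> (B ` I) = {1..k}" using that B_subset by blast
    then show ?thesis using total by simp
  qed
  consider (first) "I \<subseteq> {1..\<alpha>}"
    | (full) i where "i \<in> I" "i > \<alpha>" "\<beta> = 0 \<or> i > \<alpha> + r"
    | (two) i j where "\<beta> > 0" "i \<in> I" "j \<in> I" "i \<noteq> j" "i \<in> {\<alpha><..\<alpha> + r}" "j \<in> {\<alpha><..\<alpha> + r}"
    | (one) i J where "\<beta> > 0" "i \<in> {\<alpha><..\<alpha> + r}" "J \<subseteq> {1..\<alpha>}" "I = insert i J"
  proof -
    assume first: "I \<subseteq> {1..\<alpha>} \<Longrightarrow> thesis"
      and full: "\<And>i. i \<in> I \<Longrightarrow> i > \<alpha> \<Longrightarrow> \<beta> = 0 \<or> i > \<alpha> + r \<Longrightarrow> thesis"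
      and two: "\<And>i j. \<beta> > 0 \<Longrightarrow> i \<in> I \<Longrightarrow> j \<in> I \<Longrightarrow> i \<noteq> j \<Longrightarrow>
        i \<in> {\<alpha><..\<alpha> + r} \<Longrightarrow> j \<in> {\<alpha><..\<alpha> + r} \<Longrightarrow> thesis"
      and one: "\<And>i J. \<beta> > 0 \<Longrightarrow> i \<in> {\<alpha><..\<alpha> + r} \<Longrightarrow> J \<subseteq> {1..\<alpha>} \<Longrightarrow> I = insert i J \<Longrightarrow> thesis"
    show thesis
    proof (cases "I \<subseteq> {1..\<alpha>}")
      case False
      then obtain i where i: "i \<in> I" "i > \<alpha>" using I by fastforce
      show thesis
      proof (cases "\<beta> > 0 \<and> I \<subseteq> {1..\<alpha>} \<union> {i} \<and> i \<le> \<alpha> + r")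
        case True
        then show thesis using i by (intro one[of i "I - {i}"]) auto
      next
        \<comment> \<open>Either block \<open>i\<close> is itself full, or \<open>I\<close> has
          another index \<open>j > \<alpha>\<close>, which is full or joins \<open>i\<close> in case
          \<open>two\<close>.\<close>
        case nope: False
        show thesis
        proof (cases "\<beta> > 0 \<and> i \<le> \<alpha> + r")
          case True
          then obtain j where "j \<in> I" "j > \<alpha>" "j \<noteq> i"
            using nope I by fastforce
          then show thesis
            using i True full[of j] two[of i j] by force
        qed (use i full in force)
      qed
    qed (use first in blast)
  qed
  then show ?thesis
  proof cases
    case first
    then show ?thesis using bound card_UN_first by simp
  next
    case full
    then show ?thesis using B_full by (intro whole) blast
  next
    case two
    then have s: "i - \<alpha> \<in> {1..r}" "j - \<alpha> \<in> {1..r}" and "i - \<alpha> \<noteq> j - \<alpha>"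
      by auto
    then have "gap (i - \<alpha>) \<inter> gap (j - \<alpha>) = {}"
      by (intro gap_disjoint)
    moreover have "B i = {1..k} - gap (i - \<alpha>)" "B j = {1..k} - gap (j - \<alpha>)"
      using B_middle[OF two(1) s(1)] B_middle[OF two(1) s(2)] two(5,6) by simp_all
    ultimately have "{1..k} \<subseteq> B i \<union> B j" by blast
    then show ?thesis using two by (intro whole) blast
  next
    case one
    have cJ: "card J \<le> \<alpha>" using card_mono[OF _ one(3)] by simp
    have "k - (\<alpha> - card J) \<le> card (\<Union> (B ` I))"
    proof -
      have "i - \<alpha> \<in> {1..r}" using one(2) by auto
      from card_UN_insert_middle[OF one(1) this one(3)] show ?thesis
        using one(2,4) by simp
    qed
    moreover have "sum d I \<le> k - (\<alpha> - card J)"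
    proof (cases "card J = \<alpha>")
      case False
      \<comment> \<open>Here \<open>e\<close> counts the first blocks missing from \<open>J\<close>,
        less one. The demand is at most \<open>(card J + 1) * r\<close>; the rest of
        \<open>k\<close>, namely \<open>e * r + \<beta>\<close>, makes up for the
        \<open>e + 1\<close> uncovered points because \<open>r \<ge> 1\<close> and
        \<open>\<beta> \<ge> 1\<close>.\<close>
      then obtain e where e: "\<alpha> = card J + 1 + e"
        using cJ less_imp_Suc_add[of "card J" \<alpha>] by auto
      have "i \<notin> J" "finite J" using one finite_subset by auto
      then have "sum d I \<le> (card J + 1) * r"
        using bound[of I] one(4) by simp
      moreover have "k = (card J + 1) * r + e * r + \<beta>"
        by (simp add: k_eq e algebra_simps)
      moreover have "e \<le> e * r" using r_pos by simp
      moreover have "\<alpha> - card J = e + 1" using e by simp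
      ultimately show ?thesis
        using one(1) by linarith
    qed (use total in simp)
    ultimately show ?thesis by linarith
  qed
qed

section \<open>The value of \<open>N\<close>\<close>

text \<open>For \<open>\<beta> = 0\<close> the first \<alpha> blocks add up to \<open>k\<close> and
  the others are full, so the deficit is \<open>(\<alpha> - 1) * k\<close>. For
  \<open>\<beta> > 0\<close> the \<open>\<alpha> * r\<close> points of the first blocks balance the
  \<open>r\<close> gaps of size \<alpha>, so the deficit is \<open>\<alpha> * k\<close>. The
  additive form avoids truncated subtraction.\<close>

lemma sum_card_block: "(\<Sum>i\<in>{1..n}. card (B i)) + (k - 1) div r * k = k * n"
proof -
  have split: "(\<Sum>i\<in>{1..n}. card (B i)) = (\<Sum>i\<in>{1..\<alpha>}. card (B i)) + (\<Sum>i\<in>{\<alpha><..n}. card (B i))"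
    using n_ge by (subst sum.union_disjoint[symmetric]) (auto intro: sum.cong)
  have first: "(\<Sum>i\<in>{1..\<alpha>}. card (B i)) = \<alpha> * r"
    by (simp add: B_first)
  show ?thesis
  proof (cases "\<beta> = 0")
    case True
    then have "card (B i) = k" if "i \<in> {\<alpha><..n}" for i
      using that by (subst B_full) auto
    then have "(\<Sum>i\<in>{\<alpha><..n}. card (B i)) = (n - \<alpha>) * k"
      by simp
    moreover obtain a where a: "\<alpha> = Suc a" using alpha_pos by (cases \<alpha>) auto
    moreover have "(k - 1) div r = a"
    proof -
      \<comment> \<open>As \<open>r\<close> divides \<open>k\<close>, the quotient of
        \<open>k - 1\<close> drops to \<open>\<alpha> - 1\<close>.\<close>
      have "k - 1 = r - 1 + a * r" using r_pos True by (simp add: k_eq a)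
      then show ?thesis using r_pos by (auto intro!: div_nat_eqI simp: algebra_simps)
    qed
    moreover obtain m where "n = \<alpha> + m" using n_ge True le_Suc_ex by auto
    ultimately show ?thesis
      using True unfolding split first by (simp add: k_eq algebra_simps)
  next
    case False
    then obtain m where m: "n = \<alpha> + r + m" using n_ge le_Suc_ex by auto
    have "(\<Sum>i\<in>{\<alpha><..n}. card (B i)) =
        (\<Sum>i\<in>{\<alpha><..\<alpha> + r}. card (B i)) + (\<Sum>i\<in>{\<alpha> + r<..n}. card (B i))"
      using m by (subst sum.union_disjoint[symmetric]) (auto intro: sum.cong)
    moreover have "card (B i) = k - \<alpha>" if "i \<in> {\<alpha><..\<alpha> + r}" for i
    proof -
      have s: "i - \<alpha> \<in> {1..r}" using that by auto
      have "B i = {1..k} - gap (i - \<alpha>)"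
        using that False B_middle[OF _ s] by simp
      then show ?thesis
        using gap_subset[OF s] card_gap[OF s] by (simp add: card_Diff_subset finite_subset)
    qed
    moreover have "(\<Sum>i\<in>{\<alpha> + r<..n}. card (B i)) = m * k"
      using m by (simp add: B_full)
    moreover have "(k - 1) div r = \<alpha>"
    proof -
      have "k - 1 = \<beta> - 1 + \<alpha> * r" using False by (simp add: k_eq)
      then show ?thesis using beta_less by simp
    qed
    \<comment> \<open>\<open>\<alpha> \<le> k\<close> makes \<open>k - \<alpha>\<close> an honest
      difference.\<close>
    moreover obtain h where "k = \<alpha> + h"
      using r_pos le_Suc_ex[of \<alpha> k] by (auto simp: k_eq trans_le_add1)
    ultimately show ?thesis
      using m unfolding split first by (simp add: algebra_simps)
  qed
qed

end

section \<open>The code and its parameters\<close>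

theorem theorem11:
  fixes k r \<alpha> \<beta> n :: nat
  assumes "k > 0" and "r > 0" and "r \<le> k"
    and "k = \<alpha> * r + \<beta>" and "\<alpha> \<ge> 1" and "\<beta> < r"
    and "(\<beta> = 0 \<and> n \<ge> \<alpha>) \<or> (\<beta> > 0 \<and> n \<ge> \<alpha> + r)"
  shows "\<exists>N. int N = int k * int n - \<lfloor>(real k - 1) / real r\<rfloor> * int k \<and>
    is_mcbc n N k k r (\<lambda>j. {i \<in> {1..n}. j \<in> block k r \<alpha> \<beta> i})"
proof -
  interpret block_code k r \<alpha> \<beta> n
    using assms by unfold_locales auto
  \<comment> \<open>Positivity of \<open>k\<close> makes the natural number \<open>k - 1\<close>
    agree with the real difference.\<close>
  have "\<lfloor>(real k - 1) / real r\<rfloor> = int ((k - 1) div r)"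
    using floor_divide_of_nat_eq[of "k - 1" r, where ?'a = real] \<open>k > 0\<close> by (simp add: of_nat_diff)
  then have "int (\<Sum>i\<in>{1..n}. card (B i)) = int k * int n - \<lfloor>(real k - 1) / real r\<rfloor> * int k"
    using arg_cong[OF sum_card_block, of int] by (simp del: of_nat_sum)
  moreover have "is_mcbc n (\<Sum>i\<in>{1..n}. card (B i)) k k r (\<lambda>j. {i \<in> {1..n}. j \<in> B i})"
  proof (rule is_mcbc_if_hall)
    fix R :: "nat multiset" and I
    assume R: "size R = k" "set_mset R \<subseteq> {1..n}" "\<And>i. count R i \<le> r" and I: "I \<subseteq> {1..n}"
    \<comment> \<open>The support of \<open>R\<close> lies in \<open>{1..n}\<close>, so the demand
      on \<open>I\<close> is at most \<open>size R = k\<close>.\<close>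
    have "(\<Sum>i\<in>I. count R i) \<le> (\<Sum>i\<in>{1..n}. count R i)"
      using I by (intro sum_mono2) auto
    also have "\<dots> = k"
      unfolding R(1)[symmetric] size_multiset_overloaded_eq
      using R(2) by (intro sum.mono_neutral_right) (auto simp: not_in_iff)
    finally show "(\<Sum>i\<in>I. count R i) \<le> card (\<Union> (B ` I))"
      using hall_condition[OF I, of "count R"] R(3) by simp
  qed (use B_subset in blast)
  ultimately show ?thesis by blast
qed

end
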